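(* Let $G$ be a connected graph on $n\ge 2$ vertices. Then $Z_{(1)}(G)=2$ if and only if $G$ is a path graph or a cycle graph.
   Context: All graphs are finite, simple and undirected. Let $G$ be a graph, $S\subseteq V(G)$ a set of initially blue vertices (all other vertices white), and $L\subseteq V(G)$ a set of leaks. The leaky color change rule: a blue vertex $b\notin L$ which has exactly one white neighbor $w$ may force $w$ to become blue. $S$ is an $\ell$-leaky forcing set if for every choice of a set $L$ of $\ell$ leaks, repeated application of the rule eventually turns all vertices blue. $Z_{(\ell)}(G)$ is the minimum size of an $\ell$-leaky forcing set of $G$. *)

theory Defs
  imports "Graph_Theory.Graph_Theory"
begin

text \<open>
  A finite simple undirected graph is a digraph in the locale \<open>graph\<close>: finite, loop-free,
  without parallel arcs, and symmetric, so that \<open>u \<rightarrow>\<^bsub>G\<^esub> v\<close> is adjacency and each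
  undirected edge is a pair of opposite arcs.
\<close>

definition white_neighbors :: "('a, 'b) pre_digraph \<Rightarrow> 'a set \<Rightarrow> 'a \<Rightarrow> 'a set" where
  "white_neighbors G B b = {w \<in> verts G. b \<rightarrow>\<^bsub>G\<^esub> w \<and> w \<notin> B}"

text \<open>One application of the leaky color change rule; \<open>B\<close> is the set of blue vertices.\<close>

inductive leaky_step :: "('a, 'b) pre_digraph \<Rightarrow> 'a set \<Rightarrow> 'a set \<Rightarrow> 'a set \<Rightarrow> bool"
  for G :: "('a, 'b) pre_digraph" and L :: "'a set" where
  force: "\<lbrakk>b \<in> B; b \<notin> L; white_neighbors G B b = {w}\<rbrakk> \<Longrightarrow> leaky_step G L B (insert w B)"

text \<open>
  The rule only permits a force, so \<open>S\<close> turns everything blue if some sequence of forces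
  does. The order of forces is immaterial: a permitted force remains permitted, unless its
  target is already blue, when more vertices become blue.
\<close>

definition leaky_forcing_set :: "('a, 'b) pre_digraph \<Rightarrow> nat \<Rightarrow> 'a set \<Rightarrow> bool" where
  "leaky_forcing_set G l S \<longleftrightarrow> S \<subseteq> verts G \<and>
     (\<forall>L. L \<subseteq> verts G \<and> card L = l \<longrightarrow> (leaky_step G L)\<^sup>*\<^sup>* S (verts G))"

definition leaky_forcing_number :: "nat \<Rightarrow> ('a, 'b) pre_digraph \<Rightarrow> nat" where
  "leaky_forcing_number l G = (LEAST k. \<exists>S. leaky_forcing_set G l S \<and> card S = k)"

text \<open>The minimum is attained: the set of all vertices is always a leaky forcing set.\<close>

lemma leaky_forcing_set_verts: "leaky_forcing_set G l (verts G)"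
  by (simp add: leaky_forcing_set_def)

definition path_graph :: "nat \<Rightarrow> nat pair_pre_digraph" where
  "path_graph n = \<lparr>pverts = {..<n},
     parcs = {(i, j). i < n \<and> j < n \<and> (j = Suc i \<or> i = Suc j)}\<rparr>"

definition cycle_graph :: "nat \<Rightarrow> nat pair_pre_digraph" where
  "cycle_graph n = \<lparr>pverts = {..<n},
     parcs = {(i, j). i < n \<and> j < n \<and> (j = Suc i mod n \<or> i = Suc j mod n)}\<rparr>"

definition is_path_graph :: "('a, 'b) pre_digraph \<Rightarrow> bool" where
  "is_path_graph G \<longleftrightarrow> (\<exists>n\<ge>1. digraph_iso G (with_proj (path_graph n)))"

text \<open>The bound excludes the degenerate cases, where \<open>cycle_graph\<close> has a loop or is a single edge.\<close>

definition is_cycle_graph :: "('a, 'b) pre_digraph \<Rightarrow> bool" where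
  "is_cycle_graph G \<longleftrightarrow> (\<exists>n\<ge>3. digraph_iso G (with_proj (cycle_graph n)))"

lemma pair_graph_path_graph: "pair_graph (path_graph n)"
proof -
  have "finite (parcs (path_graph n))"
    by (rule finite_subset[of _ "{..<n} \<times> {..<n}"]) (auto simp: path_graph_def)
  then show ?thesis
    by unfold_locales (auto simp: path_graph_def symmetric_def arcs_ends_def arc_to_ends_def sym_def)
qed

lemma pair_graph_cycle_graph:
  assumes "n \<ge> 3"
  shows "pair_graph (cycle_graph n)"
proof -
  have "finite (parcs (cycle_graph n))"
    by (rule finite_subset[of _ "{..<n} \<times> {..<n}"]) (auto simp: cycle_graph_def)
  moreover have "Suc i mod n \<noteq> i \<and> i \<noteq> Suc i mod n" if "i < n" for i
    using assms that by (cases "Suc i = n") auto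
  ultimately show ?thesis
    by unfold_locales (auto simp: cycle_graph_def symmetric_def arcs_ends_def arc_to_ends_def sym_def)
qed

end

theory Submission
  imports Defs
begin

text \<open>
  Among the connected graphs with at least two vertices, the paths and cycles are those whose
  vertices can be listed so that two of them are adjacent exactly when they are consecutive, with
  the pair (first, last) left open: on three or more vertices, the graph is a cycle if that pair is
  adjacent and a path otherwise. The theorem is proved for this common
  description (\<open>near_path_order\<close>), and isomorphism with the standard path or cycle enters only
  through \<open>near_path_order_if_path_or_cycle\<close> and \<open>path_or_cycle_if_near_path_order\<close>.

  A single blue vertex is never enough, since it may itself be the leak
  (\<open>one_leaky_forcing_set_card_ge_2\<close>). So the question is when two vertices suffice.

  Given such a listing, colour both ends. The blue vertices always form an initial and a final
  segment of the list, and while a gap remains, the two vertices bordering it each have exactly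
  one white neighbour. A single leak can silence only one of them, so the gap closes
  (\<open>near_path_order_forces\<close>).

  Conversely, let \<open>{u, v}\<close> force against every leak; three different leaks are used.
  With the leak at \<open>u\<close>, only \<open>v\<close> and its successors can force, and every vertex
  that has forced is left without white neighbours. Hence the vertices other than \<open>u\<close> form an
  induced path \<open>v = x\<^sub>0, x\<^sub>1, \<dots>, x\<^sub>m\<close> (\<open>forcing_chain\<close>). If \<open>m > 0\<close>, then with the leak at \<open>v\<close> the
  first force must come from \<open>u\<close>, so \<open>u\<close> has exactly one neighbour \<open>x\<^sub>k\<close> with \<open>k > 0\<close>. With the
  leak at this \<open>x\<^sub>k\<close>, forcing is confined to \<open>u, x\<^sub>0, \<dots>, x\<^sub>k\<close>: the vertex \<open>u\<close> and the segment
  \<open>x\<^sub>0, \<dots>, x\<^sub>k\<close> touch the rest of the graph only at \<open>x\<^sub>k\<close>. Therefore \<open>k = m\<close>, and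
  \<open>x\<^sub>0, \<dots>, x\<^sub>m, u\<close> is a listing of the required kind
  (\<open>near_path_order_if_two_forcing\<close>).
\<close>

section \<open>Paths and cycles as vertex orderings\<close>

text \<open>
  The adjacency of the two ends is left open, so that paths and cycles are covered at once. A
  list of length two is thereby unconstrained, and only connectedness makes its graph an edge.
\<close>

definition near_path_order :: "('a, 'b) pre_digraph \<Rightarrow> 'a list \<Rightarrow> bool" where
  "near_path_order G xs \<longleftrightarrow> distinct xs \<and> set xs = verts G \<and>
     (\<forall>i j. i < j \<longrightarrow> j < length xs \<longrightarrow> i \<noteq> 0 \<or> Suc j \<noteq> length xs \<longrightarrow>
       (xs ! i \<rightarrow>\<^bsub>G\<^esub> xs ! j \<longleftrightarrow> j = Suc i))"

lemma (in sym_digraph) adj_commute: "u \<rightarrow>\<^bsub>G\<^esub> v \<longleftrightarrow> v \<rightarrow>\<^bsub>G\<^esub> u"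
  using arcs_ends_symmetric[OF sym_arcs] by blast

text \<open>
  Isomorphisms onto a digraph with vertices \<open>{..<n}\<close> are handled through the list of the preimages
  of \<open>0, \<dots>, n - 1\<close>. Arcs of a \<open>pair_pre_digraph\<close> are pairs of vertices, so the map on arcs
  is determined by the map on vertices, and only adjacency matters.
\<close>

lemma (in wf_digraph) digraph_iso_with_projD:
  assumes "digraph_iso G (with_proj H)" and "pverts H = {..<n}"
  obtains xs where "distinct xs" "set xs = verts G" "length xs = n"
    "\<And>i j. i < n \<Longrightarrow> j < n \<Longrightarrow> xs ! i \<rightarrow>\<^bsub>G\<^esub> xs ! j \<longleftrightarrow> (i, j) \<in> parcs H"
proof -
  obtain hom where hom: "digraph_isomorphism hom" and H: "with_proj H = app_iso hom G"
    using assms(1) by (auto simp: digraph_iso_def)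
  define f where "f = iso_verts hom"
  define g where "g = the_inv_into (verts G) f"
  have inj: "inj_on f (verts G)"
    using hom unfolding f_def by (rule digraph_isomorphism_inj_on_verts)
  have im: "f ` verts G = {..<n}"
    using arg_cong[OF H, of verts] assms(2) by (simp add: f_def)
  have arcs: "parcs H = iso_arcs hom ` arcs G"
    using arg_cong[OF H, of arcs] by simp
  have proj: "iso_tail hom = fst" "iso_head hom = snd"
    using arg_cong[OF H, of tail] arg_cong[OF H, of head] by auto
  have bij: "bij_betw g {..<n} (verts G)"
    unfolding g_def using inj im by (metis bij_betw_def bij_betw_the_inv_into)
  have fg: "f (g i) = i" if "i < n" for i
    unfolding g_def using that inj im by (simp add: f_the_inv_into_f)
  have gf: "g (f v) = v" if "v \<in> verts G" for v
    unfolding g_def using that inj by (simp add: the_inv_into_f_f)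
  have ends: "iso_arcs hom a = (f (tail G a), f (head G a))" if "a \<in> arcs G" for a
    using iso_verts_tail[OF hom that] iso_verts_head[OF hom that]
    by (simp add: proj f_def prod_eq_iff)
  have adj: "g i \<rightarrow>\<^bsub>G\<^esub> g j \<longleftrightarrow> (i, j) \<in> parcs H" if "i < n" "j < n" for i j
  proof
    assume "g i \<rightarrow>\<^bsub>G\<^esub> g j"
    then obtain a where "a \<in> arcs G" "tail G a = g i" "head G a = g j" ..
    then show "(i, j) \<in> parcs H"
      using ends fg that unfolding arcs by force
  next
    assume "(i, j) \<in> parcs H"
    then obtain a where a: "a \<in> arcs G" "i = f (tail G a)" "j = f (head G a)"
      unfolding arcs using ends by auto
    then have "g i = tail G a" "g j = head G a"
      using gf by auto
    then show "g i \<rightarrow>\<^bsub>G\<^esub> g j"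
      using a(1) by (auto simp: arcs_ends_conv)
  qed
  show thesis
  proof (rule that[of "map g [0..<n]"])
    show "distinct (map g [0..<n])" "set (map g [0..<n]) = verts G"
      using bij by (auto simp: distinct_map bij_betw_def atLeast0LessThan)
  qed (use adj in auto)
qed

text \<open>
  The converse sends each arc to the pair of positions of its ends; this is injective because
  there are no parallel arcs.
\<close>

lemma (in nomulti_digraph) digraph_iso_with_projI:
  assumes "distinct xs" "set xs = verts G" and "pverts H = {..<length xs}"
    and sub: "parcs H \<subseteq> {..<length xs} \<times> {..<length xs}"
    and adj: "\<And>i j. i < length xs \<Longrightarrow> j < length xs \<Longrightarrow>
      xs ! i \<rightarrow>\<^bsub>G\<^esub> xs ! j \<longleftrightarrow> (i, j) \<in> parcs H"
  shows "digraph_iso G (with_proj H)"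
proof -
  have bij: "bij_betw ((!) xs) {..<length xs} (verts G)"
    using assms by (intro bij_betw_nth) auto
  define f where "f = the_inv_into {..<length xs} ((!) xs)"
  have f: "bij_betw f (verts G) {..<length xs}"
    unfolding f_def using bij by (rule bij_betw_the_inv_into)
  have fx: "f (xs ! i) = i" if "i < length xs" for i
    unfolding f_def using bij that by (simp add: bij_betw_def the_inv_into_f_f)
  have xf: "f v < length xs" "xs ! f v = v" if "v \<in> verts G" for v
  proof -
    show "f v < length xs"
      using f that by (auto simp: bij_betw_def)
    show "xs ! f v = v"
      unfolding f_def using bij that by (auto simp: bij_betw_def f_the_inv_into_f)
  qed
  define h where "h = (\<lambda>a. (f (tail G a), f (head G a)))"
  define hom where "hom = \<lparr>iso_verts = f, iso_arcs = h,
    iso_head = (snd :: nat \<times> nat \<Rightarrow> nat), iso_tail = fst\<rparr>"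
  have "inj_on h (arcs G)"
  proof (rule inj_onI)
    fix a b assume ab: "a \<in> arcs G" "b \<in> arcs G" and "h a = h b"
    then have "tail G a = tail G b" "head G a = head G b"
      using f by (auto simp: h_def bij_betw_def inj_on_eq_iff)
    with ab show "a = b"
      by (intro no_multi_arcs) (auto simp: arc_to_ends_def)
  qed
  then have "digraph_isomorphism hom"
    using f wf_digraph by (auto simp: digraph_isomorphism_def hom_def h_def bij_betw_def)
  moreover have "parcs H = h ` arcs G"
  proof (intro equalityI subsetI)
    fix e assume e: "e \<in> parcs H"
    then obtain i j where ij: "e = (i, j)" "i < length xs" "j < length xs"
      using sub by auto
    then have "xs ! i \<rightarrow>\<^bsub>G\<^esub> xs ! j"
      using adj e by simp
    then obtain a where "a \<in> arcs G" "tail G a = xs ! i" "head G a = xs ! j" ..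
    then show "e \<in> h ` arcs G"
      using ij fx by (force simp: h_def)
  next
    fix e assume "e \<in> h ` arcs G"
    then obtain a where a: "a \<in> arcs G" "e = (f (tail G a), f (head G a))"
      by (auto simp: h_def)
    then have "tail G a \<rightarrow>\<^bsub>G\<^esub> head G a"
      by (auto simp: arcs_ends_conv)
    then show "e \<in> parcs H"
      using adj[of "f (tail G a)" "f (head G a)"] a xf by simp
  qed
  then have "with_proj H = app_iso hom G"
    using f assms(3) by (simp add: app_iso_def with_proj_def hom_def bij_betw_def)
  ultimately show ?thesis
    unfolding digraph_iso_def by blast
qed

lemma (in wf_digraph) near_path_order_if_path_or_cycle:
  assumes "is_path_graph G \<or> is_cycle_graph G"
  obtains xs where "near_path_order G xs"
  using assms
proof
  assume "is_path_graph G"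
  then obtain n where "digraph_iso G (with_proj (path_graph n))"
    by (auto simp: is_path_graph_def)
  then obtain xs where "distinct xs" "set xs = verts G" "length xs = n"
    "\<And>i j. i < n \<Longrightarrow> j < n \<Longrightarrow> xs ! i \<rightarrow>\<^bsub>G\<^esub> xs ! j \<longleftrightarrow> (i, j) \<in> parcs (path_graph n)"
    by (rule digraph_iso_with_projD) (simp add: path_graph_def, blast)
  then have "near_path_order G xs"
    by (auto simp: near_path_order_def path_graph_def)
  then show thesis ..
next
  assume "is_cycle_graph G"
  then obtain n where "digraph_iso G (with_proj (cycle_graph n))"
    by (auto simp: is_cycle_graph_def)
  then obtain xs where "distinct xs" "set xs = verts G" "length xs = n"
    "\<And>i j. i < n \<Longrightarrow> j < n \<Longrightarrow> xs ! i \<rightarrow>\<^bsub>G\<^esub> xs ! j \<longleftrightarrow> (i, j) \<in> parcs (cycle_graph n)"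
    by (rule digraph_iso_with_projD) (simp add: cycle_graph_def, blast)
  then have "near_path_order G xs"
    by (auto simp: near_path_order_def cycle_graph_def mod_Suc)
  then show thesis ..
qed

lemma (in graph) path_or_cycle_if_near_path_order:
  assumes ord: "near_path_order G xs" and conn: "connected G" and n: "length xs \<ge> 2"
  shows "is_path_graph G \<or> is_cycle_graph G"
proof -
  let ?n = "length xs"
  let ?ends = "xs ! 0 \<rightarrow>\<^bsub>G\<^esub> last xs"
  have xs: "distinct xs" "set xs = verts G"
    and adj: "\<And>i j. i < j \<Longrightarrow> j < ?n \<Longrightarrow> i \<noteq> 0 \<or> Suc j \<noteq> ?n \<Longrightarrow>
      xs ! i \<rightarrow>\<^bsub>G\<^esub> xs ! j \<longleftrightarrow> j = Suc i"
    using ord by (auto simp: near_path_order_def)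
  have last: "xs ! j = last xs" if "Suc j = ?n" for j
    using that n by (metis diff_Suc_1 last_conv_nth list.size(3) nat.distinct(1))
  have adj_iff: "xs ! i \<rightarrow>\<^bsub>G\<^esub> xs ! j \<longleftrightarrow>
      (if i = 0 \<and> Suc j = ?n \<or> j = 0 \<and> Suc i = ?n then ?ends else j = Suc i \<or> i = Suc j)"
    if "i < ?n" "j < ?n" for i j
  proof (cases i j rule: linorder_cases)
    case less
    then show ?thesis using adj[of i j] that last[of j] by auto
  next
    case equal
    then show ?thesis using adj_not_same n by auto
  next
    case greater
    then show ?thesis using adj[of j i] that last[of i] adj_commute[of "xs ! i" "xs ! j"] by auto
  qed
  \<comment> \<open>The list says nothing about two vertices; connectedness makes them adjacent.\<close>
  have two: ?ends if "?n = 2"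
  proof -
    have v: "xs ! 0 \<in> verts G" "xs ! 1 \<in> verts G" "xs ! 0 \<noteq> xs ! 1"
      using xs that nth_eq_iff_index_eq[of xs 0 1] by (auto simp flip: xs(2))
    have V: "verts G = {xs ! 0, xs ! 1}"
      using that by (simp flip: xs(2) add: set_conv_nth) (auto simp: less_2_cases_iff)
    have "xs ! 0 \<rightarrow>\<^sup>*\<^bsub>mk_symmetric G\<^esub> xs ! 1"
      using conn v by (auto simp: connected_def strongly_connected_def)
    then have "xs ! 0 \<rightarrow>\<^sup>*\<^bsub>G\<^esub> xs ! 1"
      by (simp only: reachable_mk_symmetric_eq[OF sym_arcs])
    then have "(xs ! 0, xs ! 1) \<in> (arcs_ends G)\<^sup>*"
      by (rule reachable_rtranclI)
    then obtain w where w: "xs ! 0 \<rightarrow>\<^bsub>G\<^esub> w"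
      using v(3) by (meson converse_rtranclE)
    then have "w \<in> {xs ! 0, xs ! 1}" "w \<noteq> xs ! 0"
      using adj_in_verts(2)[OF w] adj_not_same by (auto simp only: V)
    then have "w = xs ! 1"
      by simp
    with w show ?thesis
      using that last[of 1] by simp
  qed
  show ?thesis
  \<comment> \<open>Two adjacent vertices form a path although their ends are adjacent.\<close>
  proof (cases "?ends \<and> ?n \<noteq> 2")
    case True
    have "digraph_iso G (with_proj (cycle_graph ?n))"
    proof (rule digraph_iso_with_projI[OF xs])
      fix i j assume ij: "i < ?n" "j < ?n"
      show "xs ! i \<rightarrow>\<^bsub>G\<^esub> xs ! j \<longleftrightarrow> (i, j) \<in> parcs (cycle_graph ?n)"
        unfolding adj_iff[OF ij] using ij True n by (auto simp: cycle_graph_def mod_Suc)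
    qed (auto simp: cycle_graph_def)
    then show ?thesis
      using True n unfolding is_cycle_graph_def
      by (metis One_nat_def Suc_1 Suc_leI le_neq_implies_less numeral_3_eq_3)
  next
    case False
    have "digraph_iso G (with_proj (path_graph ?n))"
    proof (rule digraph_iso_with_projI[OF xs])
      fix i j assume ij: "i < ?n" "j < ?n"
      show "xs ! i \<rightarrow>\<^bsub>G\<^esub> xs ! j \<longleftrightarrow> (i, j) \<in> parcs (path_graph ?n)"
        unfolding adj_iff[OF ij] using ij False n two by (auto simp: path_graph_def)
    qed (auto simp: path_graph_def)
    then show ?thesis
      using n unfolding is_path_graph_def by (metis One_nat_def Suc_1 Suc_leD)
  qed
qed

section \<open>One blue vertex does not suffice\<close>

lemma leaky_steps_stuck:
  assumes "(leaky_step G L)\<^sup>*\<^sup>* S B" and "S \<subseteq> L"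
  shows "B = S"
  using assms by (induction rule: rtranclp_induct) (auto simp: leaky_step.simps white_neighbors_def)

text \<open>
  A set of at most one vertex can be covered by a single leak, and then nothing is ever forced.
\<close>

lemma (in fin_digraph) one_leaky_forcing_set_card_ge_2:
  assumes "leaky_forcing_set G 1 S" and "card (verts G) \<ge> 2"
  shows "card S \<ge> 2"
proof (rule ccontr)
  assume small: "\<not> card S \<ge> 2"
  have S: "S \<subseteq> verts G"
    using assms(1) by (simp add: leaky_forcing_set_def)
  then have "finite S"
    using finite_verts finite_subset by blast
  have "verts G \<noteq> {}"
    using assms(2) by auto
  have "\<exists>L. S \<subseteq> L \<and> L \<subseteq> verts G \<and> card L = 1"
  proof (cases "S = {}")
    case True
    then show ?thesis
      using \<open>verts G \<noteq> {}\<close> by (auto intro!: exI[of _ "{SOME v. v \<in> verts G}"] simp: some_in_eq)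
  next
    case False
    then have "card S = 1"
      using small \<open>finite S\<close> by (metis One_nat_def Suc_1 card_0_eq less_2_cases not_less)
    then show ?thesis
      using S by blast
  qed
  then obtain L where "S \<subseteq> L" "L \<subseteq> verts G" "card L = 1"
    by blast
  with assms(1) have "verts G = S"
    by (intro leaky_steps_stuck) (auto simp: leaky_forcing_set_def)
  with small assms(2) show False
    by simp
qed

section \<open>The two ends of a path or cycle\<close>

text \<open>
  The white vertices are those strictly between positions \<open>p\<close> and \<open>q\<close>. Both borders of this gap
  can force inwards unless they leak, and at most one of them leaks; induction on the width of
  the gap covers every position of the leak. A possible edge between the two ends of the list is
  harmless because both ends are blue.
\<close>

lemma (in sym_digraph) near_path_order_forces:
  assumes ord: "near_path_order G xs" and L: "card L = 1"
    and "p < q" "q < length xs"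
  shows "(leaky_step G L)\<^sup>*\<^sup>* {xs ! i |i. i < length xs \<and> (i \<le> p \<or> q \<le> i)} (verts G)"
  using assms(3,4)
proof (induction "q - p" arbitrary: p q)
  case 0
  then show ?case by simp
next
  case (Suc m)
  have xs: "distinct xs" "set xs = verts G"
    and adj: "\<And>i j. i < j \<Longrightarrow> j < length xs \<Longrightarrow> i \<noteq> 0 \<or> Suc j \<noteq> length xs \<Longrightarrow>
      xs ! i \<rightarrow>\<^bsub>G\<^esub> xs ! j \<longleftrightarrow> j = Suc i"
    using ord by (auto simp: near_path_order_def)
  let ?B = "\<lambda>p q. {xs ! i |i. i < length xs \<and> (i \<le> p \<or> q \<le> i)}"
  have white: "white_neighbors G (?B p q) b = {xs ! i |i. p < i \<and> i < q \<and> b \<rightarrow>\<^bsub>G\<^esub> xs ! i}" for b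
  proof (intro equalityI subsetI)
    fix w assume "w \<in> white_neighbors G (?B p q) b"
    then have w: "w \<in> set xs" "b \<rightarrow>\<^bsub>G\<^esub> w" "w \<notin> ?B p q"
      using xs by (simp_all add: white_neighbors_def)
    then obtain i where "i < length xs" "w = xs ! i"
      by (auto simp: in_set_conv_nth)
    moreover from this w(3) have "\<not> i \<le> p" "\<not> q \<le> i"
      by auto
    ultimately show "w \<in> {xs ! i |i. p < i \<and> i < q \<and> b \<rightarrow>\<^bsub>G\<^esub> xs ! i}"
      using w(2) by auto
  next
    fix w assume "w \<in> {xs ! i |i. p < i \<and> i < q \<and> b \<rightarrow>\<^bsub>G\<^esub> xs ! i}"
    then obtain i where i: "w = xs ! i" "p < i" "i < q" "b \<rightarrow>\<^bsub>G\<^esub> w"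
      by auto
    have "k = i" if "w = xs ! k" "k < length xs" for k
      using that i xs(1) Suc.prems by (simp add: nth_eq_iff_index_eq)
    then have "w \<notin> ?B p q"
      using i by fastforce
    moreover have "w \<in> verts G"
      using i Suc.prems by (simp flip: xs(2))
    ultimately show "w \<in> white_neighbors G (?B p q) b"
      using i(4) by (simp add: white_neighbors_def)
  qed
  show ?case
  proof (cases "q = Suc p")
    case True
    then have "?B p q = verts G"
      unfolding xs(2)[symmetric] set_conv_nth by (auto simp: Suc_le_eq not_le)
    then show ?thesis by simp
  next
    case False
    obtain l where l: "L = {l}"
      using L by (auto simp: card_1_singleton_iff)
    have "xs ! p \<noteq> xs ! q"
      using xs Suc.prems by (simp add: nth_eq_iff_index_eq)
    then consider "xs ! p \<notin> L" | "xs ! q \<notin> L"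
      using l by (cases "xs ! p = l") auto
    then show ?thesis
    proof cases
      case 1
      have "white_neighbors G (?B p q) (xs ! p) = {xs ! Suc p}"
        unfolding white
        using adj[of p] Suc.prems False by auto
      then have "leaky_step G L (?B p q) (insert (xs ! Suc p) (?B p q))"
        using 1 Suc.prems by (intro leaky_step.force) auto
      also have "insert (xs ! Suc p) (?B p q) = ?B (Suc p) q"
        using Suc.prems by (auto simp: le_Suc_eq)
      finally show ?thesis
        using Suc.hyps(1)[of q "Suc p"] Suc.hyps(2) Suc.prems False
        by (intro converse_rtranclp_into_rtranclp[of "leaky_step G L" "?B p q" "?B (Suc p) q"]) auto
    next
      case 2
      have "white_neighbors G (?B p q) (xs ! q) = {xs ! (q - 1)}"
        unfolding white adj_commute[of "xs ! q"]
        using adj[of _ q] Suc.prems False by auto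
      then have "leaky_step G L (?B p q) (insert (xs ! (q - 1)) (?B p q))"
        using 2 Suc.prems by (intro leaky_step.force) auto
      also have "insert (xs ! (q - 1)) (?B p q) = ?B p (q - 1)"
      proof -
        have "q - 1 \<le> i \<longleftrightarrow> i = q - 1 \<or> q \<le> i" for i by auto
        then show ?thesis using Suc.prems by auto
      qed
      finally show ?thesis
        using Suc.hyps(1)[of "q - 1" p] Suc.hyps(2) Suc.prems False
        by (intro converse_rtranclp_into_rtranclp[of "leaky_step G L" "?B p q" "?B p (q - 1)"]) auto
    qed
  qed
qed

lemma (in sym_digraph) near_path_order_ends_forcing:
  assumes ord: "near_path_order G xs" and n: "length xs \<ge> 2"
  shows "leaky_forcing_set G 1 {xs ! 0, xs ! (length xs - 1)}"
  unfolding leaky_forcing_set_def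
proof (intro conjI allI impI)
  show "{xs ! 0, xs ! (length xs - 1)} \<subseteq> verts G"
    using ord nth_mem[of 0 xs] nth_mem[of "length xs - 1" xs] n
    by (cases "xs = []") (simp_all add: near_path_order_def)
  fix L assume "L \<subseteq> verts G \<and> card L = 1"
  then have "(leaky_step G L)\<^sup>*\<^sup>*
      {xs ! i |i. i < length xs \<and> (i \<le> 0 \<or> length xs - 1 \<le> i)} (verts G)"
    using n by (intro near_path_order_forces[OF ord]) auto
  also have "{xs ! i |i. i < length xs \<and> (i \<le> 0 \<or> length xs - 1 \<le> i)} =
      {xs ! 0, xs ! (length xs - 1)}"
  proof -
    have "i < length xs \<and> (i \<le> 0 \<or> length xs - 1 \<le> i) \<longleftrightarrow> i = 0 \<or> i = length xs - 1" for i
      using n by auto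
    then show ?thesis by auto
  qed
  finally show "(leaky_step G L)\<^sup>*\<^sup>* {xs ! 0, xs ! (length xs - 1)} (verts G)" .
qed

section \<open>Two vertices that force through every leak\<close>

text \<open>
  The list grows by one vertex with each force. The invariant that makes this work is that all
  vertices of the list but the last have no white neighbours left: so the next force is made by the
  last vertex, and the vertex that it turns blue is adjacent to no earlier one.
\<close>

lemma forcing_chain:
  assumes "(leaky_step G {u})\<^sup>*\<^sup>* {u, v} B" and "u \<noteq> v"
  shows "\<exists>xs. xs \<noteq> [] \<and> hd xs = v \<and> distinct (u # xs) \<and> B = insert u (set xs) \<and>
    (\<forall>i. Suc i < length xs \<longrightarrow> white_neighbors G B (xs ! i) = {}) \<and>
    (\<forall>i j. i < j \<longrightarrow> j < length xs \<longrightarrow> (xs ! i \<rightarrow>\<^bsub>G\<^esub> xs ! j \<longleftrightarrow> j = Suc i))"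
  using assms(1)
proof (induction rule: rtranclp_induct)
  case base
  show ?case
    using assms(2) by (intro exI[of _ "[v]"]) auto
next
  case (step B B')
  then obtain xs where xs: "xs \<noteq> []" "hd xs = v" "distinct (u # xs)" "B = insert u (set xs)"
    and sat: "\<And>i. Suc i < length xs \<Longrightarrow> white_neighbors G B (xs ! i) = {}"
    and adj: "\<And>i j. i < j \<Longrightarrow> j < length xs \<Longrightarrow> xs ! i \<rightarrow>\<^bsub>G\<^esub> xs ! j \<longleftrightarrow> j = Suc i"
    by blast
  from step.hyps(2) obtain b w where b: "b \<in> B" "b \<noteq> u" and w: "white_neighbors G B b = {w}"
    and B': "B' = insert w B"
    unfolding leaky_step.simps by blast
  have wB: "w \<notin> B" "w \<in> verts G" "b \<rightarrow>\<^bsub>G\<^esub> w"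
    using w by (auto simp: white_neighbors_def)
  obtain i where i: "i < length xs" "b = xs ! i"
    using b xs(4) by (auto simp: in_set_conv_nth)
  then have last: "Suc i = length xs"
    using sat[of i] w by fastforce
  have to_w: "xs ! k \<rightarrow>\<^bsub>G\<^esub> w \<longleftrightarrow> Suc k = length xs" if "k < length xs" for k
  proof (cases "Suc k = length xs")
    case True
    then have "k = i" using last by simp
    then show ?thesis using wB i last by simp
  next
    case False
    then show ?thesis using sat[of k] that wB by (auto simp: white_neighbors_def)
  qed
  have sat': "white_neighbors G B' (xs ! k) = {}" if "k < length xs" for k
  proof (cases "Suc k = length xs")
    case True
    then have "k = i" using last by simp
    then have "xs ! k = b" using i by simp
    then show ?thesis using w unfolding B' white_neighbors_def by auto
  next
    case False
    then show ?thesis using sat[of k] that unfolding B' white_neighbors_def by auto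
  qed
  show ?case
  proof (intro exI[of _ "xs @ [w]"] conjI allI impI)
    fix k assume "Suc k < length (xs @ [w])"
    then show "white_neighbors G B' ((xs @ [w]) ! k) = {}"
      using sat' by (simp add: nth_append)
  next
    fix k j assume "k < j" "j < length (xs @ [w])"
    then show "(xs @ [w]) ! k \<rightarrow>\<^bsub>G\<^esub> (xs @ [w]) ! j \<longleftrightarrow> j = Suc k"
      using adj to_w by (auto simp: nth_append less_Suc_eq)
  qed (use xs wB B' in auto)
qed

text \<open>
  The leak at \<open>u\<close> gives the induced path on the other vertices; the leak at \<open>v\<close> and the leak at the
  unique further neighbour of \<open>u\<close> show that \<open>u\<close> attaches to the far end of this path, and otherwise at
  most to \<open>v\<close>.
\<close>

lemma (in graph) near_path_order_if_two_forcing: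
  assumes forcing: "leaky_forcing_set G 1 {u, v}" and "u \<noteq> v"
  obtains xs where "near_path_order G xs"
proof -
  have uv: "u \<in> verts G" "v \<in> verts G"
    and steps: "\<And>x. x \<in> verts G \<Longrightarrow> (leaky_step G {x})\<^sup>*\<^sup>* {u, v} (verts G)"
    using forcing by (auto simp: leaky_forcing_set_def)
  obtain xs where xs: "xs \<noteq> []" "hd xs = v" "distinct (u # xs)" "verts G = insert u (set xs)"
    and adj: "\<And>i j. i < j \<Longrightarrow> j < length xs \<Longrightarrow> xs ! i \<rightarrow>\<^bsub>G\<^esub> xs ! j \<longleftrightarrow> j = Suc i"
    using forcing_chain[OF steps[OF uv(1)] \<open>u \<noteq> v\<close>] by blast
  have x0: "xs ! 0 = v"
    using xs by (simp add: hd_conv_nth)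
  have last_only: "xs ! i \<rightarrow>\<^bsub>G\<^esub> u \<longleftrightarrow> Suc i = length xs" if i: "0 < i" "i < length xs" for i
  proof -
    have "{u, v} \<noteq> verts G"
    proof
      assume eq: "{u, v} = verts G"
      have "xs ! i \<in> {u, v}" using i(2) xs(4) eq by auto
      moreover have "xs ! i \<noteq> v" "xs ! i \<noteq> u"
        using i xs x0 nth_eq_iff_index_eq[of xs i 0] by auto
      ultimately show False by simp
    qed
    \<comment> \<open>The leak silences \<open>v\<close>, so the first force comes from \<open>u\<close>.\<close>
    then obtain C where "leaky_step G {v} {u, v} C"
      using steps[OF uv(2)] by (metis converse_rtranclpE)
    then obtain w where w: "white_neighbors G {u, v} u = {w}"
      unfolding leaky_step.simps by auto
    then have "w \<noteq> u" "w \<noteq> v" "w \<in> verts G"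
      by (auto simp: white_neighbors_def)
    then obtain k where k: "k < length xs" "w = xs ! k"
      using xs(4) by (auto simp: in_set_conv_nth)
    have nbr_u: "x = w \<or> x = v" if "u \<rightarrow>\<^bsub>G\<^esub> x" for x
      using that w adj_in_verts(2)[OF that] adj_not_same[of u] by (auto simp: white_neighbors_def)
    have uw: "u \<rightarrow>\<^bsub>G\<^esub> w"
      using w by (auto simp: white_neighbors_def)
    have k_last: "Suc k = length xs"
    proof (rule ccontr)
      assume not_last: "Suc k \<noteq> length xs"
      \<comment> \<open>A leak at \<open>w\<close> seals off the rest of the path.\<close>
      have "B \<subseteq> insert u ((!) xs ` {..k})"
        if "(leaky_step G {w})\<^sup>*\<^sup>* {u, v} B" for B
        using that
      proof (induction rule: rtranclp_induct)
        case base
        then show ?case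
          using x0 by auto
      next
        case (step B B')
        let ?T = "insert u ((!) xs ` {..k})"
        from step.hyps(2) obtain b y where b: "b \<in> B" "b \<noteq> w"
          and y: "white_neighbors G B b = {y}" and B': "B' = insert y B"
          unfolding leaky_step.simps by blast
        have by_adj: "b \<rightarrow>\<^bsub>G\<^esub> y" "y \<in> verts G"
          using y by (auto simp: white_neighbors_def)
        have wv: "w \<in> ?T" "v \<in> ?T"
          using k x0 by auto
        have "y \<in> ?T"
        proof (cases "b = u")
          case True
          then show ?thesis using nbr_u by_adj wv by auto
        next
          case False
          then obtain i where i: "i \<le> k" "b = xs ! i"
            using b step.IH by auto
          with b k have "i < k" by (cases "i = k") auto
          show ?thesis
          proof (cases "y = u")
            case False
            then obtain j where j: "j < length xs" "y = xs ! j"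
              using by_adj xs(4) by (auto simp: in_set_conv_nth)
            have "j \<le> Suc i"
              using adj[of i j] by_adj i j by (cases "i < j") auto
            then show ?thesis
              using \<open>i < k\<close> j by auto
          qed simp
        qed
        then show ?case
          using step.IH B' by simp
      qed
      from this[OF steps[OF \<open>w \<in> verts G\<close>]]
      have "xs ! Suc k \<in> insert u ((!) xs ` {..k})"
        using not_last k(1) xs(4) by auto
      moreover have "xs ! Suc k \<noteq> u"
        using not_last k(1) xs(3) by (metis Suc_lessI distinct.simps(2) nth_mem)
      ultimately obtain i where "i \<le> k" "xs ! i = xs ! Suc k"
        by auto
      then show False
        using not_last k(1) xs(3) nth_eq_iff_index_eq[of xs i "Suc k"] by simp
    qed
    have "xs ! i \<noteq> v"
      using i xs x0 nth_eq_iff_index_eq[of xs i 0] by auto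
    then have "u \<rightarrow>\<^bsub>G\<^esub> xs ! i \<longleftrightarrow> xs ! i = w"
      using nbr_u uw by auto
    also have "\<dots> \<longleftrightarrow> Suc i = length xs"
      using i k k_last xs(3) nth_eq_iff_index_eq[of xs i k] by auto
    finally show ?thesis
      using adj_commute by blast
  qed
  have "near_path_order G (xs @ [u])"
    unfolding near_path_order_def
  proof (intro conjI allI impI)
    fix i j assume ij: "i < j" "j < length (xs @ [u])" "i \<noteq> 0 \<or> Suc j \<noteq> length (xs @ [u])"
    show "(xs @ [u]) ! i \<rightarrow>\<^bsub>G\<^esub> (xs @ [u]) ! j \<longleftrightarrow> j = Suc i"
      using adj[of i j] last_only[of i] ij by (auto simp: nth_append less_Suc_eq)
  qed (use xs in auto)
  then show thesis ..
qed

theorem theorem6p1: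
  fixes G :: "('a, 'b) pre_digraph" and n :: nat
  assumes "graph G"
    and "Digraph_Component.connected G"
    and "card (verts G) = n"
    and "n \<ge> 2"
  shows "leaky_forcing_number 1 G = 2 \<longleftrightarrow> is_path_graph G \<or> is_cycle_graph G"
proof -
  interpret graph G by fact
  have len: "length xs \<ge> 2" if "near_path_order G xs" for xs
    using that assms(3,4) distinct_card[of xs] by (auto simp: near_path_order_def)
  let ?P = "\<lambda>k. \<exists>S. leaky_forcing_set G 1 S \<and> card S = k"
  show ?thesis
  proof
    assume two: "leaky_forcing_number 1 G = 2"
    have "?P (leaky_forcing_number 1 G)"
      unfolding leaky_forcing_number_def
      by (rule LeastI_ex) (use leaky_forcing_set_verts in blast)
    then obtain u v where "leaky_forcing_set G 1 {u, v}" "u \<noteq> v"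
      unfolding two by (auto simp: card_2_iff)
    then obtain xs where "near_path_order G xs"
      by (rule near_path_order_if_two_forcing)
    then show "is_path_graph G \<or> is_cycle_graph G"
      using path_or_cycle_if_near_path_order assms(2) len by blast
  next
    assume "is_path_graph G \<or> is_cycle_graph G"
    then obtain xs where xs: "near_path_order G xs"
      by (rule near_path_order_if_path_or_cycle)
    let ?S = "{xs ! 0, xs ! (length xs - 1)}"
    have "leaky_forcing_set G 1 ?S"
      using near_path_order_ends_forcing xs len by blast
    moreover have "xs ! 0 \<noteq> xs ! (length xs - 1)"
      using xs len[OF xs] nth_eq_iff_index_eq[of xs 0 "length xs - 1"]
      by (cases "xs = []") (simp_all add: near_path_order_def)
    ultimately have "?P 2"
      by (intro exI[of _ ?S]) simp
    then show "leaky_forcing_number 1 G = 2"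
      unfolding leaky_forcing_number_def
      using one_leaky_forcing_set_card_ge_2 assms(3,4) by (intro Least_equality) auto
  qed
qed

end
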